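(* Let $\alpha,\beta\in(0,1)$, let $D\ge1$ be an integer (with $D\le N$ when $J=\{1,\dots,N\}$), and let $S_D=\{\theta\in l_2(J):\ \theta_j=0\ \text{for all } j>D\}$. Let $t_{D,1-\alpha}(\sigma)$ be the $1-\alpha$ quantile of $\sum_{j=1}^D\sigma_j^2\epsilon_j^2$, i.e. $\mathbb{P}\bigl(\sum_{j=1}^D\sigma_j^2\epsilon_j^2\ge t_{D,1-\alpha}(\sigma)\bigr)=\alpha$, and let $\Phi_\alpha$ be the test $$\Phi_\alpha=\mathbf{1}_{\{\sum_{j=1}^DY_j^2>t_{D,1-\alpha}(\sigma)\}}.$$ Then $\Phi_\alpha$ is a level-$\alpha$ test: $\mathbb{P}_0(\Phi_\alpha=1)=\alpha$. Moreover, there exists an absolute constant $C$ such that, setting $$C(\alpha,\beta)=C\bigl(\log(\beta^{-1})+\log(\alpha^{-1})+\sqrt{\log(\alpha^{-1})}+\sqrt{\log(\beta^{-1})}\bigr),$$ for all $\theta\in S_D$, $$\|\theta\|_2^2\ge C(\alpha,\beta)\Bigl(\sum_{j=1}^D\sigma_j^4\Bigr)^{1/2}\ \Longrightarrow\ \mathbb{P}_\theta(\Phi_\alpha=1)>1-\beta.$$ Hence $\rho_2^2(S_D,\alpha,\beta)\le C(\alpha,\beta)\bigl(\sum_{j=1}^D\sigma_j^4\bigr)^{1/2}$.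
   Context: Model: $J=\{1,\dots,N\}$ for some integer $N\ge1$, or $J=\{1,2,3,\dots\}$. One observes $Y=(Y_j)_{j\in J}$ with $Y_j=\theta_j+\sigma_j\epsilon_j$, where $\theta=(\theta_j)_{j\in J}$ is unknown, $\sigma_j>0$ are known, and $(\epsilon_j)_{j\in J}$ are i.i.d. standard normal. $\mathbb{P}_\theta$ is the distribution of $Y$. $\|\theta\|_2^2=\sum_{j\in J}\theta_j^2$. A test is a measurable function $\Phi$ of $Y$ with values in $\{0,1\}$; the null hypothesis "$\theta=0$" is rejected iff $\Phi=1$. It has level $\alpha$ if $\mathbb{P}_0(\Phi=1)\le\alpha$. For $\mathcal{F}\subset l_2(J)$ and a level-$\alpha$ test $\Phi_\alpha$, $\rho_2(\Phi_\alpha,\mathcal{F},\beta)=\inf\{\rho>0:\ \inf_{\theta\in\mathcal{F},\|\theta\|_2\ge\rho}\mathbb{P}_\theta(\Phi_\alpha=1)>1-\beta\}$, and the $(\alpha,\beta)$ minimax rate of testing $\rho_2(\mathcal{F},\alpha,\beta)$ is the infimum of $\rho_2(\Phi_\alpha,\mathcal{F},\beta)$ over all level-$\alpha$ tests $\Phi_\alpha$. "Absolute constant" means a positive number not depending on $\alpha,\beta,D,\sigma,\theta$ or $J$. *)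

theory Defs
  imports "HOL-Probability.Probability"
begin

definition index_set :: "nat set \<Rightarrow> bool" where
  "index_set J \<longleftrightarrow> (\<exists>N\<ge>1. J = {1..N}) \<or> J = {1..}"

text \<open>Sequences indexed by \<open>J\<close> are total functions on \<open>nat\<close> that vanish outside \<open>J\<close>.\<close>

definition l2 :: "nat set \<Rightarrow> (nat \<Rightarrow> real) set" where
  "l2 J = {\<theta>. (\<forall>j. j \<notin> J \<longrightarrow> \<theta> j = 0) \<and> (\<lambda>j. (\<theta> j)\<^sup>2) summable_on J}"

definition l2_norm :: "nat set \<Rightarrow> (nat \<Rightarrow> real) \<Rightarrow> real" where
  "l2_norm J \<theta> = sqrt (\<Sum>\<^sub>\<infinity>j\<in>J. (\<theta> j)\<^sup>2)"

text \<open>The joint law of i.i.d. standard normal variables \<open>(\<epsilon>\<^sub>j)\<close>, \<open>j \<in> J\<close>.\<close>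

definition noise :: "nat set \<Rightarrow> (nat \<Rightarrow> real) measure" where
  "noise J = (\<Pi>\<^sub>M j\<in>J. density lborel std_normal_density)"

definition obs_space :: "nat set \<Rightarrow> (nat \<Rightarrow> real) measure" where
  "obs_space J = (\<Pi>\<^sub>M j\<in>J. borel)"

text \<open>The law \<open>P\<^sub>\<theta>\<close> of the observation \<open>Y\<^sub>j = \<theta>\<^sub>j + \<sigma>\<^sub>j \<epsilon>\<^sub>j\<close>.\<close>

definition obs_law :: "nat set \<Rightarrow> (nat \<Rightarrow> real) \<Rightarrow> (nat \<Rightarrow> real) \<Rightarrow> (nat \<Rightarrow> real) measure" where
  "obs_law J \<sigma> \<theta> = distr (noise J) (obs_space J) (\<lambda>\<epsilon>. \<lambda>j\<in>J. \<theta> j + \<sigma> j * \<epsilon> j)"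

definition is_test :: "nat set \<Rightarrow> ((nat \<Rightarrow> real) \<Rightarrow> nat) \<Rightarrow> bool" where
  "is_test J \<Phi> \<longleftrightarrow> \<Phi> \<in> obs_space J \<rightarrow>\<^sub>M count_space {0, 1}"

definition reject_prob ::
    "nat set \<Rightarrow> (nat \<Rightarrow> real) \<Rightarrow> (nat \<Rightarrow> real) \<Rightarrow> ((nat \<Rightarrow> real) \<Rightarrow> nat) \<Rightarrow> real" where
  "reject_prob J \<sigma> \<theta> \<Phi> =
     measure (obs_law J \<sigma> \<theta>) {y \<in> space (obs_law J \<sigma> \<theta>). \<Phi> y = 1}"

definition level_test ::
    "nat set \<Rightarrow> (nat \<Rightarrow> real) \<Rightarrow> real \<Rightarrow> ((nat \<Rightarrow> real) \<Rightarrow> nat) \<Rightarrow> bool" where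
  "level_test J \<sigma> \<alpha> \<Phi> \<longleftrightarrow> is_test J \<Phi> \<and> reject_prob J \<sigma> (\<lambda>_. 0) \<Phi> \<le> \<alpha>"

text \<open>
  The separation rates take values in \<^typ>\<open>ereal\<close>, so that the infimum of an empty set is
  \<open>\<infinity>\<close>, both for the outer infima and for the inner one over \<open>\<theta>\<close>.
\<close>

definition test_rate ::
    "nat set \<Rightarrow> (nat \<Rightarrow> real) \<Rightarrow> ((nat \<Rightarrow> real) \<Rightarrow> nat) \<Rightarrow> (nat \<Rightarrow> real) set \<Rightarrow> real \<Rightarrow> ereal" where
  "test_rate J \<sigma> \<Phi> F \<beta> =
     Inf {ereal \<rho> | \<rho>. \<rho> > 0 \<and>
       (INF \<theta>\<in>{\<theta> \<in> F. l2_norm J \<theta> \<ge> \<rho>}. ereal (reject_prob J \<sigma> \<theta> \<Phi>)) > ereal (1 - \<beta>)}"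

definition minimax_rate ::
    "nat set \<Rightarrow> (nat \<Rightarrow> real) \<Rightarrow> (nat \<Rightarrow> real) set \<Rightarrow> real \<Rightarrow> real \<Rightarrow> ereal" where
  "minimax_rate J \<sigma> F \<alpha> \<beta> = (INF \<Phi>\<in>{\<Phi>. level_test J \<sigma> \<alpha> \<Phi>}. test_rate J \<sigma> \<Phi> F \<beta>)"

definition S_space :: "nat set \<Rightarrow> nat \<Rightarrow> (nat \<Rightarrow> real) set" where
  "S_space J D = {\<theta> \<in> l2 J. \<forall>j\<in>J. j > D \<longrightarrow> \<theta> j = 0}"

definition quantile :: "'a measure \<Rightarrow> ('a \<Rightarrow> real) \<Rightarrow> real \<Rightarrow> real" where
  "quantile M X p = Inf {x. measure M {\<omega> \<in> space M. X \<omega> \<le> x} \<ge> p}"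

definition chi_quantile :: "nat set \<Rightarrow> (nat \<Rightarrow> real) \<Rightarrow> nat \<Rightarrow> real \<Rightarrow> real" where
  "chi_quantile J \<sigma> D p = quantile (noise J) (\<lambda>\<epsilon>. \<Sum>j=1..D. (\<sigma> j)\<^sup>2 * (\<epsilon> j)\<^sup>2) p"

definition chi_test :: "nat set \<Rightarrow> (nat \<Rightarrow> real) \<Rightarrow> nat \<Rightarrow> real \<Rightarrow> (nat \<Rightarrow> real) \<Rightarrow> nat" where
  "chi_test J \<sigma> D \<alpha> y = (if (\<Sum>j=1..D. (y j)\<^sup>2) > chi_quantile J \<sigma> D (1 - \<alpha>) then 1 else 0)"

definition sep_const :: "real \<Rightarrow> real \<Rightarrow> real \<Rightarrow> real" where
  "sep_const C \<alpha> \<beta> =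
     C * (ln (inverse \<beta>) + ln (inverse \<alpha>) + sqrt (ln (inverse \<alpha>)) + sqrt (ln (inverse \<beta>)))"

end

theory Submission
  imports Defs
begin

text \<open>
  Write \<open>T\<^sub>\<theta> = \<Sum>\<^sub>j\<^sub>\<le>\<^sub>D (\<theta>\<^sub>j + \<sigma>\<^sub>j \<epsilon>\<^sub>j)\<^sup>2\<close>, \<open>E = \<Sum>\<^sub>j\<^sub>\<le>\<^sub>D \<sigma>\<^sub>j\<^sup>2\<close>, \<open>S\<^sup>2 = \<Sum>\<^sub>j\<^sub>\<le>\<^sub>D \<sigma>\<^sub>j\<^sup>4\<close> and
  \<open>n = \<parallel>\<theta>\<parallel>\<^sup>2\<close>.

  The size is exactly \<open>\<alpha>\<close> because \<open>T\<^sub>0\<close> has no atoms: with all noise coordinates but one held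
  fixed, \<open>T\<^sub>0 = c\<close> leaves at most two values for the remaining one (\<open>square_sum_no_atom\<close>). Its
  distribution function is therefore continuous and takes the value \<open>1 - \<alpha>\<close> at the quantile.

  The separation bound follows from two deviation inequalities. Both are Chernoff bounds, since
  \<open>exp (u (\<theta>\<^sub>j + \<sigma>\<^sub>j \<epsilon>\<^sub>j)\<^sup>2)\<close> has an explicit Gaussian integral and independence multiplies these
  integrals. Under the null, \<open>T\<^sub>0 < E + 2 S \<surd>x + 2 S x\<close> except with probability \<open>exp (-x)\<close>
  (\<open>central_upper_tail\<close>); taking \<open>x = ln (1/\<alpha>)\<close> bounds the critical value. Under \<open>\<theta>\<close>,
  \<open>T\<^sub>\<theta> > E + n - 2 \<surd>((S\<^sup>2 + 2 S n) x)\<close> except with probability \<open>exp (-x)\<close>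
  (\<open>noncentral_lower_tail\<close>). Here \<open>x = ln (1/\<alpha>) + ln (1/\<beta>)\<close> is chosen rather than \<open>ln (1/\<beta>)\<close>:
  it costs only a constant factor in the separation and makes the type II error at most
  \<open>\<alpha> \<beta>\<close>, which is below \<open>\<beta>\<close> by a margin that does not depend on \<open>\<theta>\<close>. That uniform margin
  survives the infimum over \<open>\<theta>\<close> in the definition of the separation rate, so the bound on the
  minimax rate holds at the threshold itself.
\<close>

section \<open>Gaussian noise\<close>

abbreviation std_gauss :: "real measure" where
  "std_gauss \<equiv> density lborel std_normal_density"

lemma prob_space_std_gauss: "prob_space std_gauss"
  by (rule prob_space_normal_density) simp

lemma product_prob_space_std_gauss: "product_prob_space (\<lambda>_::nat. std_gauss)"
  by (intro product_prob_spaceI prob_space_std_gauss)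

lemma prob_space_noise: "prob_space (noise J)"
  unfolding noise_def by (intro prob_space_PiM prob_space_std_gauss)

lemma coordinate_measurable_noise:
  assumes "j \<in> J"
  shows "(\<lambda>\<epsilon>. \<epsilon> j) \<in> borel_measurable (noise J)"
proof -
  have "(\<lambda>\<epsilon>. \<epsilon> j) \<in> noise J \<rightarrow>\<^sub>M std_gauss"
    unfolding noise_def using assms by (rule measurable_component_singleton)
  then show ?thesis
    by (simp add: measurable_def)
qed

lemma square_sum_measurable_noise:
  assumes "I \<subseteq> J"
  shows "(\<lambda>\<epsilon>. \<Sum>j\<in>I. (\<theta> j + \<sigma> j * \<epsilon> j)\<^sup>2) \<in> borel_measurable (noise J)"
  by (intro borel_measurable_sum borel_measurable_power borel_measurable_add
      borel_measurable_times borel_measurable_const coordinate_measurable_noise)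
    (use assms in auto)

text \<open>
  The test statistic reads finitely many coordinates, so infinite products can be traded for
  finite ones, where Fubini and the product rule for integrals apply.
\<close>

lemma noise_restrict_finite:
  assumes "finite I" "I \<subseteq> J"
  shows "distr (noise J) (noise I) (\<lambda>\<epsilon>. restrict \<epsilon> I) = noise I"
proof -
  interpret product_prob_space "\<lambda>_::nat. std_gauss" J
    by (rule product_prob_space_std_gauss)
  show ?thesis
    unfolding noise_def using assms by (rule distr_PiM_restrict_finite)
qed

lemma restrict_measurable_noise:
  assumes "I \<subseteq> J"
  shows "(\<lambda>\<epsilon>. restrict \<epsilon> I) \<in> noise J \<rightarrow>\<^sub>M noise I"
  unfolding noise_def using assms by (rule measurable_restrict_subset)

section \<open>Exponential moments of squared Gaussians\<close>

text \<open>
  Completing the square turns the integrand, multiplied by the Gaussian density, into a constant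
  times another normal density, of variance \<open>1 / (1 - 2 u s\<^sup>2)\<close>.
\<close>

lemma std_gauss_exp_square:
  fixes u t s :: real
  assumes "2 * u * s\<^sup>2 < 1"
  shows "integrable std_gauss (\<lambda>x. exp (u * (t + s * x)\<^sup>2))" (is ?A)
    and "(\<integral>x. exp (u * (t + s * x)\<^sup>2) \<partial>std_gauss)
      = exp (u * t\<^sup>2 / (1 - 2 * u * s\<^sup>2)) / sqrt (1 - 2 * u * s\<^sup>2)" (is ?B)
proof -
  define d where "d = 1 - 2 * u * s\<^sup>2"
  have d: "d > 0" using assms by (simp add: d_def)
  have eq: "std_normal_density x * exp (u * (t + s * x)\<^sup>2)
    = exp (u * t\<^sup>2 / d) / sqrt d * normal_density (2 * u * t * s / d) (1 / sqrt d) x" for x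
  proof -
    have "- x\<^sup>2 / 2 + u * (t + s * x)\<^sup>2 = u * t\<^sup>2 / d - (x - 2 * u * t * s / d)\<^sup>2 * d / 2"
    proof -
      have "d * (- x\<^sup>2 / 2 + u * (t + s * x)\<^sup>2) =
         d * (u * t\<^sup>2 / d - (x - 2 * u * t * s / d)\<^sup>2 * d / 2)"
      proof -
        have "d * (u * t\<^sup>2 / d - (x - 2 * u * t * s / d)\<^sup>2 * d / 2)
          = u * t\<^sup>2 - (d * (x - 2 * u * t * s / d))\<^sup>2 / 2"
        proof -
          have "d * ((x - 2 * u * t * s / d)\<^sup>2 * d / 2) = (d * (x - 2 * u * t * s / d))\<^sup>2 / 2"
            unfolding power_mult_distrib by (simp add: power2_eq_square)
          moreover have "d * (u * t\<^sup>2 / d) = u * t\<^sup>2" using d by simp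
          ultimately show ?thesis by (simp only: right_diff_distrib)
        qed
        also have "d * (x - 2 * u * t * s / d) = d * x - 2 * u * t * s"
          using d by (simp add: right_diff_distrib)
        finally show ?thesis
          unfolding d_def by (simp add: power2_eq_square field_simps)
      qed
      then show ?thesis using d by simp
    qed
    moreover have "(x - 2 * u * t * s / d)\<^sup>2 / (2 * (1 / sqrt d)\<^sup>2)
        = (x - 2 * u * t * s / d)\<^sup>2 * d / 2"
      using d by (simp add: power_divide)
    ultimately have "exp (- x\<^sup>2 / 2) * exp (u * (t + s * x)\<^sup>2)
      = exp (u * t\<^sup>2 / d) * exp (- (x - 2 * u * t * s / d)\<^sup>2 / (2 * (1 / sqrt d)\<^sup>2))"
      by (simp add: exp_add[symmetric])
    moreover have "sqrt (2 * pi * (1 / sqrt d)\<^sup>2) = sqrt (2 * pi) / sqrt d"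
      using d by (simp add: power_divide real_sqrt_divide)
    ultimately show ?thesis
      unfolding normal_density_def using d by (simp add: field_simps)
  qed
  have "?A = integrable lborel (\<lambda>x. std_normal_density x * exp (u * (t + s * x)\<^sup>2))"
    by (subst integrable_density) auto
  moreover have "integrable lborel (\<lambda>x. std_normal_density x * exp (u * (t + s * x)\<^sup>2))"
    unfolding eq using d by (intro integrable_mult_right integrable_normal_density) simp
  ultimately show ?A by blast
  have "(\<integral>x. exp (u * (t + s * x)\<^sup>2) \<partial>std_gauss)
    = (\<integral>x. std_normal_density x * exp (u * (t + s * x)\<^sup>2) \<partial>lborel)"
    by (subst integral_density) auto
  also have "\<dots> = exp (u * t\<^sup>2 / d) / sqrt d"
    unfolding eq using d by (simp add: integral_normal_density)
  finally show ?B by (simp add: d_def)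
qed

lemma noise_exp_square_sum:
  fixes u :: real
  assumes "finite I" "I \<subseteq> J" and u: "\<And>j. j \<in> I \<Longrightarrow> 2 * u * (\<sigma> j)\<^sup>2 < 1"
  shows "integrable (noise J) (\<lambda>\<epsilon>. exp (u * (\<Sum>j\<in>I. (\<theta> j + \<sigma> j * \<epsilon> j)\<^sup>2)))" (is ?A)
    and "(\<integral>\<epsilon>. exp (u * (\<Sum>j\<in>I. (\<theta> j + \<sigma> j * \<epsilon> j)\<^sup>2)) \<partial>noise J)
      = (\<Prod>j\<in>I. exp (u * (\<theta> j)\<^sup>2 / (1 - 2 * u * (\<sigma> j)\<^sup>2)) / sqrt (1 - 2 * u * (\<sigma> j)\<^sup>2))" (is ?B)
proof -
  define F where "F = (\<lambda>\<epsilon>. \<Prod>j\<in>I. exp (u * (\<theta> j + \<sigma> j * \<epsilon> j)\<^sup>2))"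
  interpret product_prob_space "\<lambda>_::nat. std_gauss" I
    by (rule product_prob_space_std_gauss)
  have int: "integrable std_gauss (\<lambda>x. exp (u * (\<theta> j + \<sigma> j * x)\<^sup>2))" if "j \<in> I" for j
    using std_gauss_exp_square(1)[OF u[OF that]] .
  have F_int: "integrable (noise I) F"
    unfolding noise_def F_def by (rule product_integrable_prod[OF \<open>finite I\<close> int])
  have F_eq: "F (restrict \<epsilon> I) = exp (u * (\<Sum>j\<in>I. (\<theta> j + \<sigma> j * \<epsilon> j)\<^sup>2))" for \<epsilon>
    unfolding F_def using \<open>finite I\<close> by (simp add: exp_sum sum_distrib_left)
  note R = restrict_measurable_noise[OF \<open>I \<subseteq> J\<close>]
    and D = noise_restrict_finite[OF \<open>finite I\<close> \<open>I \<subseteq> J\<close>]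
  have F_meas: "F \<in> borel_measurable (noise I)" using F_int by simp
  show ?A
    using F_int integrable_distr_eq[OF R F_meas] by (simp add: D F_eq)
  have "(\<integral>\<epsilon>. exp (u * (\<Sum>j\<in>I. (\<theta> j + \<sigma> j * \<epsilon> j)\<^sup>2)) \<partial>noise J) = integral\<^sup>L (noise I) F"
    using integral_distr[OF R F_meas] by (simp add: D F_eq)
  also have "\<dots> = (\<Prod>j\<in>I. \<integral>x. exp (u * (\<theta> j + \<sigma> j * x)\<^sup>2) \<partial>std_gauss)"
    unfolding noise_def F_def by (rule product_integral_prod[OF \<open>finite I\<close> int])
  finally show ?B
    by (simp add: std_gauss_exp_square(2)[OF u] cong: prod.cong)
qed

text \<open>
  The sign of \<open>u\<close> decides the direction of the event, so this covers the upper tail (\<open>u > 0\<close>)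
  and the lower tail (\<open>u < 0\<close>) at once.
\<close>

lemma chernoff_square_sum:
  fixes u \<tau> :: real
  assumes "finite I" "I \<subseteq> J" and u: "\<And>j. j \<in> I \<Longrightarrow> 2 * u * (\<sigma> j)\<^sup>2 < 1"
  shows "measure (noise J)
      {\<epsilon> \<in> space (noise J). u * (\<Sum>j\<in>I. (\<theta> j + \<sigma> j * \<epsilon> j)\<^sup>2) \<ge> u * \<tau>}
    \<le> exp ((\<Sum>j\<in>I. u * (\<theta> j)\<^sup>2 / (1 - 2 * u * (\<sigma> j)\<^sup>2) - ln (1 - 2 * u * (\<sigma> j)\<^sup>2) / 2) - u * \<tau>)"
proof -
  interpret prob_space "noise J" by (rule prob_space_noise)
  let ?T = "\<lambda>\<epsilon>. \<Sum>j\<in>I. (\<theta> j + \<sigma> j * \<epsilon> j)\<^sup>2"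
  let ?e = "\<lambda>j. u * (\<theta> j)\<^sup>2 / (1 - 2 * u * (\<sigma> j)\<^sup>2) - ln (1 - 2 * u * (\<sigma> j)\<^sup>2) / 2"
  have "prob {\<epsilon> \<in> space (noise J). u * ?T \<epsilon> \<ge> u * \<tau>}
    = prob {\<epsilon> \<in> space (noise J). exp (u * ?T \<epsilon>) \<ge> exp (u * \<tau>)}"
    by simp
  also have "\<dots> \<le> (\<integral>\<epsilon>. exp (u * ?T \<epsilon>) \<partial>noise J) / exp (u * \<tau>)"
    by (rule integral_Markov_inequality_measure[where A = "{}"])
      (use noise_exp_square_sum(1)[OF assms] in auto)
  also have "(\<integral>\<epsilon>. exp (u * ?T \<epsilon>) \<partial>noise J)
    = (\<Prod>j\<in>I. exp (u * (\<theta> j)\<^sup>2 / (1 - 2 * u * (\<sigma> j)\<^sup>2)) / sqrt (1 - 2 * u * (\<sigma> j)\<^sup>2))"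
    by (rule noise_exp_square_sum(2)) (use assms in auto)
  also have "\<dots> = (\<Prod>j\<in>I. exp (?e j))"
  proof (rule prod.cong[OF refl])
    fix j assume "j \<in> I"
    then have pos: "1 - 2 * u * (\<sigma> j)\<^sup>2 > 0" using u[of j] by simp
    have "exp (ln (1 - 2 * u * (\<sigma> j)\<^sup>2) / 2) = sqrt (1 - 2 * u * (\<sigma> j)\<^sup>2)"
      unfolding ln_sqrt[OF less_imp_le[OF pos], symmetric] using pos by (intro exp_ln real_sqrt_gt_zero)
    then show "exp (u * (\<theta> j)\<^sup>2 / (1 - 2 * u * (\<sigma> j)\<^sup>2)) / sqrt (1 - 2 * u * (\<sigma> j)\<^sup>2) = exp (?e j)"
      unfolding exp_diff by (rule subst) (rule refl)
  qed
  also have "\<dots> = exp (\<Sum>j\<in>I. ?e j)"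
    by (rule exp_sum[OF \<open>finite I\<close>, symmetric])
  finally show ?thesis
    unfolding exp_diff .
qed

text \<open>
  The logarithm in the exponent of the Chernoff bound is replaced by its second-order expansion;
  \<open>b\<close> is a common bound for all the \<open>u \<sigma>\<^sub>j\<^sup>2\<close>, so that one denominator serves the whole sum.
  Both this lemma and the next hold because the difference of the two sides vanishes at \<open>0\<close> and
  has the right monotonicity.
\<close>

lemma neg_half_ln_le_upper:
  fixes a b :: real
  assumes "0 \<le> a" "a \<le> b" "2 * b < 1"
  shows "- ln (1 - 2 * a) / 2 \<le> a + a\<^sup>2 / (1 - 2 * b)"
proof -
  define f where "f = (\<lambda>x::real. x + x\<^sup>2 / (1 - 2 * b) + ln (1 - 2 * x) / 2)"
  have "f 0 \<le> f a"
  proof (rule DERIV_nonneg_imp_nondecreasing[OF \<open>0 \<le> a\<close>])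
    fix x assume x: "0 \<le> x" "x \<le> a"
    then have p: "1 - 2 * b > 0" "1 - 2 * x > 0" using assms by auto
    have "(f has_real_derivative 1 + 2 * x / (1 - 2 * b) - 1 / (1 - 2 * x)) (at x)"
    proof -
      have "((\<lambda>x. ln (1 - 2 * x) / 2) has_real_derivative - 1 / (1 - 2 * x)) (at x)"
        using p by (auto intro!: derivative_eq_intros simp: divide_simps)
      moreover have "((\<lambda>x. x + x\<^sup>2 / (1 - 2 * b)) has_real_derivative 1 + 2 * x / (1 - 2 * b)) (at x)"
        using p by (auto intro!: derivative_eq_intros)
      ultimately show ?thesis
        unfolding f_def by (auto dest: DERIV_add)
    qed
    moreover have "1 / (1 - 2 * x) = 1 + 2 * x / (1 - 2 * x)"
      using p by (simp add: field_simps)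
    moreover have "2 * x / (1 - 2 * x) \<le> 2 * x / (1 - 2 * b)"
      using p x assms by (intro divide_left_mono mult_pos_pos) auto
    ultimately show "\<exists>y. (f has_real_derivative y) (at x) \<and> 0 \<le> y"
      by (intro exI[of _ "1 + 2 * x / (1 - 2 * b) - 1 / (1 - 2 * x)"]) auto
  qed
  then show ?thesis by (simp add: f_def)
qed

lemma neg_half_ln_le_lower:
  fixes a :: real
  assumes "0 \<le> a"
  shows "- ln (1 + 2 * a) / 2 \<le> - a + a\<^sup>2"
proof -
  define f where "f = (\<lambda>x::real. - x + x\<^sup>2 + ln (1 + 2 * x) / 2)"
  have "f 0 \<le> f a"
  proof (rule DERIV_nonneg_imp_nondecreasing[OF \<open>0 \<le> a\<close>])
    fix x assume x: "0 \<le> x" "x \<le> a"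
    have "(f has_real_derivative -1 + 2 * x + 1 / (1 + 2 * x)) (at x)"
      unfolding f_def using x by (auto intro!: derivative_eq_intros simp: field_simps)
    moreover have "-1 + 2 * x + 1 / (1 + 2 * x) = 4 * x\<^sup>2 / (1 + 2 * x)"
      using x by (simp add: field_simps power2_eq_square)
    ultimately show "\<exists>y. (f has_real_derivative y) (at x) \<and> 0 \<le> y"
      using x by (intro exI[of _ "4 * x\<^sup>2 / (1 + 2 * x)"]) auto
  qed
  then show ?thesis by (simp add: f_def)
qed

section \<open>Deviation inequalities\<close>

lemma square_le_sqrt_sum_fourth:
  fixes \<sigma> :: "nat \<Rightarrow> real"
  assumes "finite I" "j \<in> I"
  shows "(\<sigma> j)\<^sup>2 \<le> sqrt (\<Sum>j\<in>I. \<sigma> j ^ 4)"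
proof (rule real_le_rsqrt)
  have "((\<sigma> j)\<^sup>2)\<^sup>2 = \<sigma> j ^ 4" by (simp flip: power_mult)
  also have "\<dots> \<le> (\<Sum>j\<in>I. \<sigma> j ^ 4)"
    using assms by (intro member_le_sum) auto
  finally show "((\<sigma> j)\<^sup>2)\<^sup>2 \<le> (\<Sum>j\<in>I. \<sigma> j ^ 4)" .
qed

lemma sqrt_sum_fourth_pos:
  fixes \<sigma> :: "nat \<Rightarrow> real"
  assumes "finite I" "I \<noteq> {}" "\<And>j. j \<in> I \<Longrightarrow> \<sigma> j > 0"
  shows "sqrt (\<Sum>j\<in>I. \<sigma> j ^ 4) > 0"
proof -
  have "(\<Sum>j\<in>I. \<sigma> j ^ 4) > 0"
    using assms by (intro sum_pos zero_less_power)
  then show ?thesis by simp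
qed

text \<open>
  The exponent of the Chernoff bound is at most
  \<open>u\<^sup>2 S\<^sup>2 / (1 - 2 u S) - u (2 S \<surd>x + 2 S x)\<close>, and the \<open>u\<close> solving
  \<open>u S = \<surd>x / (1 + 2 \<surd>x)\<close> makes it equal to \<open>-x\<close>.
\<close>

lemma central_upper_tail:
  fixes \<sigma> :: "nat \<Rightarrow> real" and x :: real
  assumes I: "finite I" "I \<subseteq> J" "I \<noteq> {}" and pos: "\<And>j. j \<in> I \<Longrightarrow> \<sigma> j > 0" and x: "x > 0"
  defines "S \<equiv> sqrt (\<Sum>j\<in>I. \<sigma> j ^ 4)"
  shows "measure (noise J) {\<epsilon> \<in> space (noise J).
      (\<Sum>j\<in>I. (\<sigma> j)\<^sup>2 * (\<epsilon> j)\<^sup>2) \<ge> (\<Sum>j\<in>I. (\<sigma> j)\<^sup>2) + 2 * S * sqrt x + 2 * S * x} \<le> exp (- x)"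
proof -
  have S: "S > 0" unfolding S_def using sqrt_sum_fourth_pos I pos by blast
  have S2: "S\<^sup>2 = (\<Sum>j\<in>I. \<sigma> j ^ 4)" unfolding S_def by (simp add: sum_nonneg)
  define r where "r = sqrt x"
  have r: "r > 0" "x = r\<^sup>2" using x by (auto simp: r_def)
  have x_eq: "x = r * r" using r by (simp add: power2_eq_square)
  define u where "u = r / (S * (1 + 2 * r))"
  have u: "u > 0" unfolding u_def using S r by simp
  have uS: "1 - 2 * (u * S) = 1 / (1 + 2 * r)"
  proof -
    have "u * S = r / (1 + 2 * r)" unfolding u_def using S by simp
    then show ?thesis using r by (simp add: field_simps)
  qed
  have uS1: "2 * (u * S) < 1"
  proof -
    have "1 / (1 + 2 * r) > 0" using r by simp
    then show ?thesis using uS by linarith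
  qed
  let ?\<tau> = "(\<Sum>j\<in>I. (\<sigma> j)\<^sup>2) + 2 * S * sqrt x + 2 * S * x"
  have le: "u * (\<sigma> j)\<^sup>2 \<le> u * S" if "j \<in> I" for j
    using square_le_sqrt_sum_fourth[OF I(1) that] u by (simp add: S_def)
  have "measure (noise J) {\<epsilon> \<in> space (noise J). u * (\<Sum>j\<in>I. (0 + \<sigma> j * \<epsilon> j)\<^sup>2) \<ge> u * ?\<tau>}
    \<le> exp ((\<Sum>j\<in>I. u * 0\<^sup>2 / (1 - 2 * u * (\<sigma> j)\<^sup>2) - ln (1 - 2 * u * (\<sigma> j)\<^sup>2) / 2) - u * ?\<tau>)"
    by (rule chernoff_square_sum[OF I(1,2), where \<theta> = "\<lambda>_. 0"]) (use le uS1 in fastforce)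
  also have "\<dots> \<le> exp ((\<Sum>j\<in>I. u * (\<sigma> j)\<^sup>2 + u\<^sup>2 * \<sigma> j ^ 4 * (1 + 2 * r)) - u * ?\<tau>)"
  proof (subst exp_le_cancel_iff, intro diff_right_mono sum_mono)
    fix j assume j: "j \<in> I"
    have "- ln (1 - 2 * (u * (\<sigma> j)\<^sup>2)) / 2 \<le> u * (\<sigma> j)\<^sup>2 + (u * (\<sigma> j)\<^sup>2)\<^sup>2 / (1 - 2 * (u * S))"
      using u uS1 by (intro neg_half_ln_le_upper le[OF j]) auto
    then show "u * 0\<^sup>2 / (1 - 2 * u * (\<sigma> j)\<^sup>2) - ln (1 - 2 * u * (\<sigma> j)\<^sup>2) / 2
        \<le> u * (\<sigma> j)\<^sup>2 + u\<^sup>2 * \<sigma> j ^ 4 * (1 + 2 * r)"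
      unfolding uS by (simp add: power_mult_distrib mult.assoc flip: power_mult)
  qed
  also have "(\<Sum>j\<in>I. u * (\<sigma> j)\<^sup>2 + u\<^sup>2 * \<sigma> j ^ 4 * (1 + 2 * r)) - u * ?\<tau>
      = (u * S)\<^sup>2 * (1 + 2 * r) - 2 * (u * S) * (r + r\<^sup>2)"
    using r by (simp add: sum.distrib sum_distrib_left[symmetric] sum_distrib_right[symmetric]
        S2[symmetric] r_def[symmetric] x_eq power_mult_distrib algebra_simps)
  also have "\<dots> = - x"
  proof -
    have "u * S = r / (1 + 2 * r)" unfolding u_def using S by simp
    moreover have "(r / (1 + 2 * r))\<^sup>2 * (1 + 2 * r) = r\<^sup>2 / (1 + 2 * r)"
      using r by (simp add: power_divide power2_eq_square)
    moreover have "r\<^sup>2 / (1 + 2 * r) - 2 * (r / (1 + 2 * r)) * (r + r\<^sup>2) = - r\<^sup>2"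
    proof -
      have "r\<^sup>2 / (1 + 2 * r) - 2 * (r / (1 + 2 * r)) * (r + r\<^sup>2)
          = (- r\<^sup>2 * (1 + 2 * r)) / (1 + 2 * r)"
        unfolding times_divide_eq_right times_divide_eq_left diff_divide_distrib[symmetric]
        by (simp add: power2_eq_square algebra_simps)
      then show ?thesis using r by simp
    qed
    ultimately show ?thesis using r by simp
  qed
  finally show ?thesis
    using u by (simp add: power_mult_distrib)
qed

text \<open>
  With \<open>-u\<close> in place of \<open>u\<close>, the noncentrality contributes
  \<open>- u \<theta>\<^sub>j\<^sup>2 / (1 + 2 u \<sigma>\<^sub>j\<^sup>2) \<le> - u \<theta>\<^sub>j\<^sup>2 + 2 u\<^sup>2 S \<theta>\<^sub>j\<^sup>2\<close>. The exponent is then at most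
  \<open>u\<^sup>2 V - 2 u \<surd>(V x)\<close> with \<open>V = S\<^sup>2 + 2 S n\<close>, whose minimum over \<open>u\<close> is \<open>-x\<close>.
\<close>

lemma noncentral_lower_tail:
  fixes \<sigma> \<theta> :: "nat \<Rightarrow> real" and x :: real
  assumes I: "finite I" "I \<subseteq> J" "I \<noteq> {}" and pos: "\<And>j. j \<in> I \<Longrightarrow> \<sigma> j > 0" and x: "x > 0"
  defines "S \<equiv> sqrt (\<Sum>j\<in>I. \<sigma> j ^ 4)" and "n \<equiv> (\<Sum>j\<in>I. (\<theta> j)\<^sup>2)"
  shows "measure (noise J) {\<epsilon> \<in> space (noise J). (\<Sum>j\<in>I. (\<theta> j + \<sigma> j * \<epsilon> j)\<^sup>2)
      \<le> (\<Sum>j\<in>I. (\<sigma> j)\<^sup>2) + n - 2 * sqrt ((S\<^sup>2 + 2 * S * n) * x)} \<le> exp (- x)"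
proof -
  have S: "S > 0" unfolding S_def using sqrt_sum_fourth_pos I pos by blast
  have S2: "S\<^sup>2 = (\<Sum>j\<in>I. \<sigma> j ^ 4)" unfolding S_def by (simp add: sum_nonneg)
  have n: "n \<ge> 0" unfolding n_def by (simp add: sum_nonneg)
  define V where "V = S\<^sup>2 + 2 * S * n"
  have V: "V > 0" unfolding V_def using S n by (simp add: add_pos_nonneg)
  define u where "u = sqrt (x / V)"
  have u: "u > 0" unfolding u_def using V x by simp
  have u2: "u\<^sup>2 * V = x" and uV: "u * sqrt (V * x) = x"
    unfolding u_def using V x by (simp_all add: real_sqrt_mult[symmetric] power2_eq_square)
  let ?\<tau> = "(\<Sum>j\<in>I. (\<sigma> j)\<^sup>2) + n - 2 * sqrt (V * x)"
  have "measure (noise J) {\<epsilon> \<in> space (noise J).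
       (-u) * (\<Sum>j\<in>I. (\<theta> j + \<sigma> j * \<epsilon> j)\<^sup>2) \<ge> (-u) * ?\<tau>}
    \<le> exp ((\<Sum>j\<in>I. (-u) * (\<theta> j)\<^sup>2 / (1 - 2 * (-u) * (\<sigma> j)\<^sup>2)
        - ln (1 - 2 * (-u) * (\<sigma> j)\<^sup>2) / 2) - (-u) * ?\<tau>)"
  proof (rule chernoff_square_sum[OF I(1,2)])
    fix j
    have "u * (\<sigma> j)\<^sup>2 \<ge> 0" using u by simp
    then show "2 * (-u) * (\<sigma> j)\<^sup>2 < 1" by simp
  qed
  also have "\<dots> \<le> exp ((\<Sum>j\<in>I. - u * (\<theta> j)\<^sup>2 + 2 * u\<^sup>2 * S * (\<theta> j)\<^sup>2
        - u * (\<sigma> j)\<^sup>2 + u\<^sup>2 * \<sigma> j ^ 4) - (-u) * ?\<tau>)"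
  proof (subst exp_le_cancel_iff, intro diff_right_mono sum_mono)
    fix j assume j: "j \<in> I"
    define a where "a = u * (\<sigma> j)\<^sup>2"
    have a: "a \<ge> 0" "a \<le> u * S"
      unfolding a_def using u square_le_sqrt_sum_fourth[OF I(1) j] by (simp_all add: S_def)
    have "1 - 2 * a \<le> 1 / (1 + 2 * a)"
      using a by (simp add: field_simps)
    then have "(u * (\<theta> j)\<^sup>2) * (1 - 2 * (u * S)) \<le> (u * (\<theta> j)\<^sup>2) * (1 / (1 + 2 * a))"
      using u a by (intro mult_left_mono) auto
    moreover have "- ln (1 + 2 * a) / 2 \<le> - a + a\<^sup>2"
      using a by (intro neg_half_ln_le_lower)
    moreover have "a\<^sup>2 = u\<^sup>2 * \<sigma> j ^ 4"
      unfolding a_def by (simp add: power_mult_distrib flip: power_mult)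
    moreover have d_eq: "1 - 2 * (-u) * (\<sigma> j)\<^sup>2 = 1 + 2 * a"
      by (simp add: a_def)
    have "(-u) * (\<theta> j)\<^sup>2 / (1 - 2 * (-u) * (\<sigma> j)\<^sup>2) = - (u * (\<theta> j)\<^sup>2 * (1 / (1 + 2 * a)))"
      "ln (1 - 2 * (-u) * (\<sigma> j)\<^sup>2) = ln (1 + 2 * a)"
      unfolding d_eq by simp_all
    moreover have "u * (\<theta> j)\<^sup>2 * (1 - 2 * (u * S)) = u * (\<theta> j)\<^sup>2 - 2 * u\<^sup>2 * S * (\<theta> j)\<^sup>2"
      by (simp add: algebra_simps power2_eq_square)
    ultimately show "(-u) * (\<theta> j)\<^sup>2 / (1 - 2 * (-u) * (\<sigma> j)\<^sup>2) - ln (1 - 2 * (-u) * (\<sigma> j)\<^sup>2) / 2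
        \<le> - u * (\<theta> j)\<^sup>2 + 2 * u\<^sup>2 * S * (\<theta> j)\<^sup>2 - u * (\<sigma> j)\<^sup>2 + u\<^sup>2 * \<sigma> j ^ 4"
      using a_def by linarith
  qed
  also have "(\<Sum>j\<in>I. - u * (\<theta> j)\<^sup>2 + 2 * u\<^sup>2 * S * (\<theta> j)\<^sup>2 - u * (\<sigma> j)\<^sup>2 + u\<^sup>2 * \<sigma> j ^ 4) - (-u) * ?\<tau>
     = u\<^sup>2 * V - 2 * (u * sqrt (V * x))"
    by (simp add: sum.distrib sum_subtractf sum_negf sum_distrib_left[symmetric]
        S2[symmetric] n_def[symmetric] V_def algebra_simps)
  also have "\<dots> = - x" using u2 uV by simp
  finally show ?thesis
    using u by (simp add: V_def)
qed


section \<open>The null distribution and its quantile\<close>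

lemma std_gauss_finite_null:
  fixes A :: "real set"
  assumes "finite A"
  shows "emeasure std_gauss A = 0"
proof -
  have "emeasure lborel A = 0"
    using assms by (simp add: emeasure_lborel_countable countable_finite)
  moreover have "A \<in> sets borel"
    using assms by (simp add: borel_closed finite_imp_closed)
  ultimately have "A \<in> null_sets lborel" by auto
  moreover have "absolutely_continuous lborel std_gauss"
    by (intro absolutely_continuousI_density) simp
  ultimately show ?thesis
    unfolding absolutely_continuous_def by auto
qed

text \<open>
  By Fubini it is enough to integrate over the coordinate \<open>i\<close> first; the section of the event
  consists of the at most two square roots of a number.
\<close>

lemma square_sum_no_atom:
  fixes \<sigma> :: "nat \<Rightarrow> real"
  assumes I: "finite I" "I \<subseteq> J" "i \<in> I" and pos: "\<sigma> i > 0"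
  shows "measure (noise J) {\<epsilon> \<in> space (noise J). (\<Sum>j\<in>I. (\<sigma> j)\<^sup>2 * (\<epsilon> j)\<^sup>2) = c} = 0"
proof -
  define K where "K = I - {i}"
  have K: "finite K" "i \<notin> K" "I = insert i K" using I by (auto simp: K_def)
  define T where "T = (\<lambda>\<epsilon>. \<Sum>j\<in>I. (\<sigma> j)\<^sup>2 * (\<epsilon> j)\<^sup>2)"
  define A where "A = {\<epsilon> \<in> space (noise I). T \<epsilon> = c}"
  interpret product_prob_space "\<lambda>_::nat. std_gauss" I
    by (rule product_prob_space_std_gauss)
  have T_meas: "T \<in> borel_measurable (noise I)"
    using square_sum_measurable_noise[OF subset_refl, of "\<lambda>_. 0" \<sigma> I]
    by (simp add: T_def power_mult_distrib)
  then have A: "A \<in> sets (noise I)"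
    unfolding A_def by measurable
  have "emeasure (noise I) A = (\<integral>\<^sup>+ \<epsilon>. indicator A \<epsilon> \<partial>noise (insert i K))"
    using A K by simp
  also have "\<dots> = (\<integral>\<^sup>+ \<epsilon>. (\<integral>\<^sup>+ x. indicator A (\<epsilon>(i := x)) \<partial>std_gauss) \<partial>noise K)"
    using A K unfolding noise_def by (intro product_nn_integral_insert) auto
  also have "\<dots> = (\<integral>\<^sup>+ \<epsilon>. 0 \<partial>noise K)"
  proof (intro nn_integral_cong)
    fix \<epsilon>
    define c' where "c' = (c - (\<Sum>j\<in>K. (\<sigma> j)\<^sup>2 * (\<epsilon> j)\<^sup>2)) / (\<sigma> i)\<^sup>2"
    have T_upd: "T (\<epsilon>(i := x)) = (\<sigma> i)\<^sup>2 * x\<^sup>2 + (\<Sum>j\<in>K. (\<sigma> j)\<^sup>2 * (\<epsilon> j)\<^sup>2)" for x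
    proof -
      have "(\<Sum>j\<in>K. (\<sigma> j)\<^sup>2 * ((\<epsilon>(i := x)) j)\<^sup>2) = (\<Sum>j\<in>K. (\<sigma> j)\<^sup>2 * (\<epsilon> j)\<^sup>2)"
        using K by (intro sum.cong) auto
      then show ?thesis unfolding T_def using K by simp
    qed
    have "x \<in> {sqrt c', - sqrt c'}" if "T (\<epsilon>(i := x)) = c" for x
    proof -
      have "x\<^sup>2 = c'"
        using that pos unfolding T_upd c'_def by (simp add: field_simps)
      then show ?thesis
        by (metis abs_if insertCI minus_minus real_sqrt_abs)
    qed
    then have "(\<integral>\<^sup>+ x. indicator A (\<epsilon>(i := x)) \<partial>std_gauss)
        \<le> (\<integral>\<^sup>+ x. indicator {sqrt c', - sqrt c'} x \<partial>std_gauss)"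
      by (intro nn_integral_mono) (auto simp: A_def indicator_def)
    also have "\<dots> = 0"
      using std_gauss_finite_null[of "{sqrt c', - sqrt c'}"] by simp
    finally show "(\<integral>\<^sup>+ x. indicator A (\<epsilon>(i := x)) \<partial>std_gauss) = 0" by simp
  qed
  finally have "emeasure (noise I) A = 0" by simp
  then have "emeasure (distr (noise J) (noise I) (\<lambda>\<epsilon>. restrict \<epsilon> I)) A = 0"
    by (simp add: noise_restrict_finite I)
  then have "emeasure (noise J) ((\<lambda>\<epsilon>. restrict \<epsilon> I) -` A \<inter> space (noise J)) = 0"
    using emeasure_distr[OF restrict_measurable_noise[OF I(2)] A] by simp
  also have "(\<lambda>\<epsilon>. restrict \<epsilon> I) -` A \<inter> space (noise J) = {\<epsilon> \<in> space (noise J). T \<epsilon> = c}"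
    using measurable_space[OF restrict_measurable_noise[OF I(2)]]
    by (auto simp: A_def T_def)
  finally show ?thesis by (simp add: measure_def T_def)
qed

lemma (in prob_space) prob_quantile:
  fixes X :: "'a \<Rightarrow> real"
  assumes X: "random_variable borel X"
    and atom: "\<And>c. prob {\<omega> \<in> space M. X \<omega> = c} = 0"
    and p: "0 < p" "p < 1"
  shows "prob {\<omega> \<in> space M. X \<omega> \<le> quantile M X p} = p"
proof -
  interpret D: real_distribution "distr M borel X" using X by simp
  define F where "F = cdf (distr M borel X)"
  have F_eq: "F x = prob {\<omega> \<in> space M. X \<omega> \<le> x}" for x
    unfolding F_def cdf_def using X
    by (subst measure_distr) (auto intro!: arg_cong[where f = prob])
  have F_cont: "isCont F x" for x
  proof -
    have "measure (distr M borel X) {x} = prob {\<omega> \<in> space M. X \<omega> = x}"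
      using X by (subst measure_distr) (auto intro!: arg_cong[where f = prob])
    then show ?thesis unfolding F_def D.isCont_cdf by (simp add: atom)
  qed
  have "\<forall>\<^sub>F x in at_bot. F x < p"
    using D.cdf_lim_at_bot p unfolding F_def by (intro order_tendstoD) auto
  then obtain a where a: "F a < p" by (auto simp: eventually_at_bot_linorder)
  have "\<forall>\<^sub>F x in at_top. p < F x"
    using D.cdf_lim_at_top_prob p unfolding F_def by (intro order_tendstoD) auto
  then obtain b where b: "p < F b" by (auto simp: eventually_at_top_linorder)
  define Q where "Q = {x. F x \<ge> p}"
  have F_mono: "F x \<le> F y" if "x \<le> y" for x y
    using D.cdf_nondecreasing[OF that] by (simp add: F_def)
  have a_le: "a \<le> x" if "x \<in> Q" for x
    using that a F_mono[of x a] by (force simp: Q_def)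
  then have bdd: "bdd_below Q" by (rule bdd_belowI)
  have "Q \<noteq> {}" using b by (auto simp: Q_def intro: less_imp_le)
  moreover have "closed Q"
    unfolding Q_def by (intro closed_Collect_le continuous_intros continuous_at_imp_continuous_on)
      (auto intro: F_cont)
  ultimately have t_in: "Inf Q \<in> Q" using bdd by (intro closed_contains_Inf)
  have "F (Inf Q) = p"
  proof (rule ccontr)
    assume "F (Inf Q) \<noteq> p"
    then have gt: "p < F (Inf Q)" using t_in by (simp add: Q_def)
    obtain x where x: "a \<le> x" "x \<le> Inf Q" "F x = p"
      using IVT[of F a p "Inf Q"] a gt a_le[OF t_in] F_cont by force
    have "Inf Q \<le> x" using x bdd by (intro cInf_lower) (auto simp: Q_def)
    then show False using x gt by simp
  qed
  then show ?thesis
    unfolding quantile_def F_eq[symmetric] Q_def .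
qed


text \<open>
  Nonnegativity makes the set in the definition of the quantile bounded below, so that its
  infimum is a lower bound instead of an arbitrary value.
\<close>

lemma (in prob_space) quantile_le:
  fixes X :: "'a \<Rightarrow> real"
  assumes nonneg: "\<And>\<omega>. X \<omega> \<ge> 0" and "p > 0" and "prob {\<omega> \<in> space M. X \<omega> \<le> x} \<ge> p"
  shows "quantile M X p \<le> x"
  unfolding quantile_def
proof (rule cInf_lower)
  show "bdd_below {x. prob {\<omega> \<in> space M. X \<omega> \<le> x} \<ge> p}"
  proof (rule bdd_belowI[of _ 0])
    fix y assume "y \<in> {x. prob {\<omega> \<in> space M. X \<omega> \<le> x} \<ge> p}"
    then have "prob {\<omega> \<in> space M. X \<omega> \<le> y} > 0" using \<open>p > 0\<close> by simp
    then have "{\<omega> \<in> space M. X \<omega> \<le> y} \<noteq> {}" by (metis measure_empty less_irrefl)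
    then show "0 \<le> y" using nonneg order_trans by blast
  qed
qed (use assms in simp)

lemma chi_quantile_exact:
  assumes "{1..D} \<subseteq> J" "D \<ge> 1" and pos: "\<And>j. j \<in> J \<Longrightarrow> \<sigma> j > 0" and \<alpha>: "0 < \<alpha>" "\<alpha> < 1"
  defines "T \<equiv> \<lambda>\<epsilon>. \<Sum>j=1..D. (\<sigma> j)\<^sup>2 * (\<epsilon> j)\<^sup>2" and "t \<equiv> chi_quantile J \<sigma> D (1 - \<alpha>)"
  shows "measure (noise J) {\<epsilon> \<in> space (noise J). T \<epsilon> > t} = \<alpha>"
    and "measure (noise J) {\<epsilon> \<in> space (noise J). T \<epsilon> \<ge> t} = \<alpha>"
proof -
  interpret prob_space "noise J" by (rule prob_space_noise)
  have T[measurable]: "random_variable borel T"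
    using square_sum_measurable_noise[OF assms(1), of "\<lambda>_. 0" \<sigma>]
    by (simp add: T_def power_mult_distrib)
  have atom: "prob {\<epsilon> \<in> space (noise J). T \<epsilon> = c} = 0" for c
    unfolding T_def using assms(1,2) pos
    by (intro square_sum_no_atom[where i = 1]) auto
  have "prob {\<epsilon> \<in> space (noise J). T \<epsilon> \<le> t} = 1 - \<alpha>"
    unfolding t_def chi_quantile_def T_def[symmetric]
    using T atom \<alpha> by (intro prob_quantile) auto
  moreover have "prob {\<epsilon> \<in> space (noise J). T \<epsilon> > t}
      = 1 - prob {\<epsilon> \<in> space (noise J). T \<epsilon> \<le> t}"
    using prob_neg[of "\<lambda>\<epsilon>. T \<epsilon> \<le> t"] by (simp add: not_le)
  ultimately show gt: "prob {\<epsilon> \<in> space (noise J). T \<epsilon> > t} = \<alpha>" by simp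
  have "prob {\<epsilon> \<in> space (noise J). T \<epsilon> \<ge> t}
      = prob ({\<epsilon> \<in> space (noise J). T \<epsilon> > t} \<union> {\<epsilon> \<in> space (noise J). T \<epsilon> = t})"
    by (intro arg_cong[where f = prob]) auto
  also have "\<dots> = \<alpha>"
    by (subst finite_measure_Union) (auto simp: gt atom)
  finally show "prob {\<epsilon> \<in> space (noise J). T \<epsilon> \<ge> t} = \<alpha>" .
qed

lemma chi_quantile_le:
  assumes "{1..D} \<subseteq> J" "D \<ge> 1" and pos: "\<And>j. j \<in> J \<Longrightarrow> \<sigma> j > 0" and \<alpha>: "0 < \<alpha>" "\<alpha> < 1"
  defines "S \<equiv> sqrt (\<Sum>j=1..D. \<sigma> j ^ 4)" and "x \<equiv> ln (inverse \<alpha>)"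
  shows "chi_quantile J \<sigma> D (1 - \<alpha>) \<le> (\<Sum>j=1..D. (\<sigma> j)\<^sup>2) + 2 * S * sqrt x + 2 * S * x"
    (is "_ \<le> ?\<tau>")
  unfolding chi_quantile_def
proof (rule prob_space.quantile_le[OF prob_space_noise])
  interpret prob_space "noise J" by (rule prob_space_noise)
  let ?T = "\<lambda>\<epsilon>. \<Sum>j=1..D. (\<sigma> j)\<^sup>2 * (\<epsilon> j)\<^sup>2"
  show "0 \<le> ?T \<epsilon>" for \<epsilon> by (simp add: sum_nonneg)
  show "0 < 1 - \<alpha>" using \<alpha> by simp
  have [measurable]: "random_variable borel ?T"
    using square_sum_measurable_noise[OF assms(1), of "\<lambda>_. 0" \<sigma>]
    by (simp add: power_mult_distrib)
  have x: "x > 0" "exp (- x) = \<alpha>"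
    unfolding x_def using \<alpha> by (simp_all add: ln_inverse)
  have "prob {\<epsilon> \<in> space (noise J). ?T \<epsilon> \<ge> ?\<tau>} \<le> exp (- x)"
    unfolding S_def by (rule central_upper_tail) (use assms(1,2) pos x(1) in auto)
  then have "prob {\<epsilon> \<in> space (noise J). ?T \<epsilon> \<ge> ?\<tau>} \<le> \<alpha>"
    by (simp only: x(2))
  moreover have "prob {\<epsilon> \<in> space (noise J). ?T \<epsilon> < ?\<tau>}
      = 1 - prob {\<epsilon> \<in> space (noise J). ?T \<epsilon> \<ge> ?\<tau>}"
  proof -
    have "{\<epsilon> \<in> space (noise J). ?T \<epsilon> \<ge> ?\<tau>} \<in> events" by measurable
    from prob_neg[OF this] show ?thesis by (simp only: not_le)
  qed
  moreover have "prob {\<epsilon> \<in> space (noise J). ?T \<epsilon> < ?\<tau>} \<le> prob {\<epsilon> \<in> space (noise J). ?T \<epsilon> \<le> ?\<tau>}"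
  proof (rule finite_measure_mono)
    show "{\<epsilon> \<in> space (noise J). ?T \<epsilon> < ?\<tau>} \<subseteq> {\<epsilon> \<in> space (noise J). ?T \<epsilon> \<le> ?\<tau>}"
      using less_imp_le by blast
  qed measurable
  ultimately show "1 - \<alpha> \<le> prob {\<epsilon> \<in> space (noise J). ?T \<epsilon> \<le> ?\<tau>}" by linarith
qed

section \<open>The test and its power\<close>

lemma chi_test_is_test:
  assumes "{1..D} \<subseteq> J"
  shows "is_test J (chi_test J \<sigma> D \<alpha>)"
proof -
  have [measurable]: "(\<lambda>y. \<Sum>j=1..D. (y j)\<^sup>2) \<in> borel_measurable (obs_space J)"
    unfolding obs_space_def
    by (intro borel_measurable_sum borel_measurable_power measurable_component_singleton)
      (use assms in auto)
  show ?thesis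
    unfolding is_test_def chi_test_def by measurable
qed

lemma reject_prob_chi_test:
  assumes "{1..D} \<subseteq> J"
  shows "reject_prob J \<sigma> \<theta> (chi_test J \<sigma> D \<alpha>) = measure (noise J) {\<epsilon> \<in> space (noise J).
      (\<Sum>j=1..D. (\<theta> j + \<sigma> j * \<epsilon> j)\<^sup>2) > chi_quantile J \<sigma> D (1 - \<alpha>)}"
proof -
  let ?Y = "\<lambda>\<epsilon>. \<lambda>j\<in>J. \<theta> j + \<sigma> j * \<epsilon> j"
  have Y: "?Y \<in> noise J \<rightarrow>\<^sub>M obs_space J"
    unfolding obs_space_def
    by (intro measurable_restrict borel_measurable_add borel_measurable_times
        borel_measurable_const coordinate_measurable_noise)
  have "chi_test J \<sigma> D \<alpha> \<in> obs_space J \<rightarrow>\<^sub>M count_space {0, 1}"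
    using chi_test_is_test[OF assms] unfolding is_test_def .
  from measurable_sets[OF this, of "{1}"]
  have R: "{y \<in> space (obs_space J). chi_test J \<sigma> D \<alpha> y = 1} \<in> sets (obs_space J)"
    by (simp add: vimage_def Int_def conj_commute)
  have "(\<Sum>j=1..D. (?Y \<epsilon> j)\<^sup>2) = (\<Sum>j=1..D. (\<theta> j + \<sigma> j * \<epsilon> j)\<^sup>2)" for \<epsilon>
    using assms by (intro sum.cong) auto
  then have "?Y -` {y \<in> space (obs_space J). chi_test J \<sigma> D \<alpha> y = 1} \<inter> space (noise J)
      = {\<epsilon> \<in> space (noise J). (\<Sum>j=1..D. (\<theta> j + \<sigma> j * \<epsilon> j)\<^sup>2) > chi_quantile J \<sigma> D (1 - \<alpha>)}"
    using measurable_space[OF Y] by (auto simp: chi_test_def split: if_splits)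
  then show ?thesis
    unfolding reject_prob_def obs_law_def space_distr measure_distr[OF Y R] by (rule arg_cong)
qed

lemma l2_norm_S_space:
  assumes "\<theta> \<in> S_space J D" "{1..D} \<subseteq> J" "0 \<notin> J"
  shows "(l2_norm J \<theta>)\<^sup>2 = (\<Sum>j=1..D. (\<theta> j)\<^sup>2)"
proof -
  have "\<theta> j = 0" if "j \<in> J - {1..D}" for j
    using that assms by (cases "j = 0") (auto simp: S_space_def)
  then have "(\<Sum>\<^sub>\<infinity>j\<in>J. (\<theta> j)\<^sup>2) = (\<Sum>\<^sub>\<infinity>j\<in>{1..D}. (\<theta> j)\<^sup>2)"
    using assms(2) by (intro infsum_cong_neutral) auto
  then show ?thesis unfolding l2_norm_def by (simp add: sum_nonneg)
qed

text \<open>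
  The two sides are the excess over \<open>E\<close> of the upper bound for the critical value and of the
  lower bound for the test statistic. The mixed term \<open>2 \<surd>(2 S n x)\<close> with \<open>x = xa + xb\<close> is
  absorbed by the arithmetic-geometric mean inequality into \<open>n / 2 + 4 S x\<close>, leaving half of
  \<open>n\<close> to dominate \<open>S (4 \<surd>xa + 2 \<surd>xb + 6 xa + 4 xb)\<close>. Twice the largest coefficient here is the
  constant \<open>12\<close>.
\<close>

lemma separation_margin:
  fixes S n xa xb :: real
  assumes "S > 0" "n \<ge> 0" "xa > 0" "xb > 0"
    and sep: "n \<ge> 12 * (xb + xa + sqrt xa + sqrt xb) * S"
  shows "2 * S * sqrt xa + 2 * S * xa \<le> n - 2 * sqrt ((S\<^sup>2 + 2 * S * n) * (xa + xb))"
proof -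
  let ?x = "xa + xb"
  have "sqrt ((S\<^sup>2 + 2 * S * n) * ?x) \<le> sqrt (S\<^sup>2 * ?x) + sqrt (2 * S * n * ?x)"
    using assms by (subst distrib_right, intro sqrt_add_le_add_sqrt) auto
  also have "sqrt (S\<^sup>2 * ?x) = S * sqrt ?x"
    using assms by (simp add: real_sqrt_mult)
  also have "S * sqrt ?x \<le> S * (sqrt xa + sqrt xb)"
    using assms by (intro mult_left_mono sqrt_add_le_add_sqrt) auto
  also have "sqrt (2 * S * n * ?x) \<le> (n / 2 + 4 * S * ?x) / 2"
  proof -
    have "n / 2 * (4 * S * ?x) = 2 * S * n * ?x" by simp
    moreover have "sqrt (n / 2 * (4 * S * ?x)) \<le> (n / 2 + 4 * S * ?x) / 2"
      using assms by (intro arith_geo_mean_sqrt) auto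
    ultimately show ?thesis by (simp only:)
  qed
  finally have mean: "sqrt ((S\<^sup>2 + 2 * S * n) * ?x)
      \<le> S * (sqrt xa + sqrt xb) + (n / 2 + 4 * S * ?x) / 2"
    by simp
  have 1: "2 * sqrt ((S\<^sup>2 + 2 * S * n) * ?x)
      \<le> 2 * (S * sqrt xa) + 2 * (S * sqrt xb) + n / 2 + 4 * (S * xa) + 4 * (S * xb)"
  proof -
    have "2 * sqrt ((S\<^sup>2 + 2 * S * n) * ?x)
        \<le> 2 * (S * (sqrt xa + sqrt xb) + (n / 2 + 4 * S * ?x) / 2)"
      by (rule mult_left_mono[OF mean]) simp
    also have "\<dots> = 2 * (S * sqrt xa) + 2 * (S * sqrt xb) + n / 2 + 4 * (S * xa) + 4 * (S * xb)"
      by (simp add: algebra_simps)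
    finally show ?thesis .
  qed
  have "S * sqrt xa \<ge> 0" "S * sqrt xb \<ge> 0" "S * xa \<ge> 0" "S * xb \<ge> 0"
    using assms by auto
  moreover have "n \<ge> 12 * (S * xb) + 12 * (S * xa) + 12 * (S * sqrt xa) + 12 * (S * sqrt xb)"
    using sep by (simp add: algebra_simps)
  moreover have "2 * S * sqrt xa = 2 * (S * sqrt xa)" "2 * S * xa = 2 * (S * xa)" by simp_all
  ultimately show ?thesis using 1 by linarith
qed

text \<open>
  The type II error bound \<open>\<alpha> \<beta>\<close> is the value of \<open>exp (-x)\<close> at
  \<open>x = ln (1/\<alpha>) + ln (1/\<beta>)\<close>.
\<close>

lemma chi_test_power:
  assumes "{1..D} \<subseteq> J" "0 \<notin> J" "D \<ge> 1" and pos: "\<And>j. j \<in> J \<Longrightarrow> \<sigma> j > 0"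
    and \<alpha>: "0 < \<alpha>" "\<alpha> < 1" and \<beta>: "0 < \<beta>" "\<beta> < 1" and \<theta>: "\<theta> \<in> S_space J D"
    and sep: "(l2_norm J \<theta>)\<^sup>2 \<ge> sep_const 12 \<alpha> \<beta> * sqrt (\<Sum>j=1..D. \<sigma> j ^ 4)"
  shows "reject_prob J \<sigma> \<theta> (chi_test J \<sigma> D \<alpha>) \<ge> 1 - \<alpha> * \<beta>"
proof -
  interpret prob_space "noise J" by (rule prob_space_noise)
  let ?T = "\<lambda>\<epsilon>. \<Sum>j=1..D. (\<theta> j + \<sigma> j * \<epsilon> j)\<^sup>2"
  have [measurable]: "random_variable borel ?T"
    by (rule square_sum_measurable_noise[OF assms(1)])
  define S where "S = sqrt (\<Sum>j=1..D. \<sigma> j ^ 4)"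
  define n where "n = (\<Sum>j=1..D. (\<theta> j)\<^sup>2)"
  define xa where "xa = ln (inverse \<alpha>)"
  define xb where "xb = ln (inverse \<beta>)"
  define t where "t = chi_quantile J \<sigma> D (1 - \<alpha>)"
  let ?\<tau> = "(\<Sum>j=1..D. (\<sigma> j)\<^sup>2) + n - 2 * sqrt ((S\<^sup>2 + 2 * S * n) * (xa + xb))"
  have S: "S > 0"
    unfolding S_def by (rule sqrt_sum_fourth_pos) (use assms(1,3) pos in auto)
  have n: "n \<ge> 0" unfolding n_def by (simp add: sum_nonneg)
  have x: "xa > 0" "xb > 0" "exp (- (xa + xb)) = \<alpha> * \<beta>"
    unfolding xa_def xb_def using \<alpha> \<beta> by (simp_all add: ln_inverse exp_add)
  have "t \<le> (\<Sum>j=1..D. (\<sigma> j)\<^sup>2) + 2 * S * sqrt xa + 2 * S * xa"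
    unfolding t_def S_def xa_def using assms(1,3) pos \<alpha> by (rule chi_quantile_le)
  moreover have "2 * S * sqrt xa + 2 * S * xa \<le> n - 2 * sqrt ((S\<^sup>2 + 2 * S * n) * (xa + xb))"
    using sep S n x l2_norm_S_space[OF \<theta> assms(1,2)]
    by (intro separation_margin) (simp_all add: sep_const_def n_def S_def xa_def xb_def)
  ultimately have "t \<le> ?\<tau>" by linarith
  then have "{\<epsilon> \<in> space (noise J). ?T \<epsilon> \<le> t} \<subseteq> {\<epsilon> \<in> space (noise J). ?T \<epsilon> \<le> ?\<tau>}"
    using order_trans by blast
  then have "prob {\<epsilon> \<in> space (noise J). ?T \<epsilon> \<le> t} \<le> prob {\<epsilon> \<in> space (noise J). ?T \<epsilon> \<le> ?\<tau>}"
    by (rule finite_measure_mono) measurable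
  also have "\<dots> \<le> exp (- (xa + xb))"
    unfolding S_def n_def by (rule noncentral_lower_tail) (use assms(1,3) pos x(1,2) in auto)
  also have "\<dots> = \<alpha> * \<beta>" by (rule x(3))
  finally have "prob {\<epsilon> \<in> space (noise J). ?T \<epsilon> \<le> t} \<le> \<alpha> * \<beta>" .
  moreover have "prob {\<epsilon> \<in> space (noise J). ?T \<epsilon> > t}
      = 1 - prob {\<epsilon> \<in> space (noise J). ?T \<epsilon> \<le> t}"
  proof -
    have "{\<epsilon> \<in> space (noise J). ?T \<epsilon> \<le> t} \<in> events" by measurable
    from prob_neg[OF this] show ?thesis by (simp only: not_le)
  qed
  ultimately show ?thesis
    unfolding reject_prob_chi_test[OF assms(1)] t_def[symmetric] by linarith
qed

lemma test_rate_nonneg: "test_rate J \<sigma> \<Phi> F \<beta> \<ge> 0"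
  unfolding test_rate_def by (rule Inf_greatest) auto

text \<open>
  The power must exceed \<open>1 - \<beta>\<close> by a fixed margin, here through \<open>q\<close>, because a strict bound at
  each \<open>\<theta>\<close> separately would only give a weak bound for the infimum.
\<close>

lemma minimax_rate_square_le:
  assumes "level_test J \<sigma> \<alpha> \<Phi>" "K > 0" "q > 1 - \<beta>"
    and power: "\<And>\<theta>. \<theta> \<in> F \<Longrightarrow> (l2_norm J \<theta>)\<^sup>2 \<ge> K \<Longrightarrow> reject_prob J \<sigma> \<theta> \<Phi> \<ge> q"
  shows "(minimax_rate J \<sigma> F \<alpha> \<beta>)\<^sup>2 \<le> ereal K"
proof -
  have "reject_prob J \<sigma> \<theta> \<Phi> \<ge> q" if "\<theta> \<in> F" "l2_norm J \<theta> \<ge> sqrt K" for \<theta>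
  proof (rule power[OF that(1)])
    show "K \<le> (l2_norm J \<theta>)\<^sup>2"
      using that(2) by (rule sqrt_le_D)
  qed
  then have "ereal q \<le> (INF \<theta>\<in>{\<theta> \<in> F. l2_norm J \<theta> \<ge> sqrt K}. ereal (reject_prob J \<sigma> \<theta> \<Phi>))"
    by (intro INF_greatest) auto
  moreover have "ereal (1 - \<beta>) < ereal q" using \<open>q > 1 - \<beta>\<close> by simp
  ultimately have "(INF \<theta>\<in>{\<theta> \<in> F. l2_norm J \<theta> \<ge> sqrt K}. ereal (reject_prob J \<sigma> \<theta> \<Phi>)) > ereal (1 - \<beta>)"
    by (rule less_le_trans[rotated])
  then have "test_rate J \<sigma> \<Phi> F \<beta> \<le> ereal (sqrt K)"
    unfolding test_rate_def using \<open>K > 0\<close> by (intro Inf_lower) auto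
  then have le: "minimax_rate J \<sigma> F \<alpha> \<beta> \<le> ereal (sqrt K)"
    unfolding minimax_rate_def using assms(1) by (intro INF_lower2) auto
  have "minimax_rate J \<sigma> F \<alpha> \<beta> \<ge> 0"
    unfolding minimax_rate_def by (intro INF_greatest test_rate_nonneg)
  then have "(minimax_rate J \<sigma> F \<alpha> \<beta>)\<^sup>2 \<le> ereal (sqrt K) * ereal (sqrt K)"
    unfolding power2_eq_square using le \<open>K > 0\<close> by (intro ereal_mult_mono) auto
  then show ?thesis using \<open>K > 0\<close> by simp
qed

theorem proposition2:
  "\<exists>C::real. C > 0 \<and>
    (\<forall>(J::nat set) (\<sigma>::nat \<Rightarrow> real) (D::nat) (\<alpha>::real) (\<beta>::real).
      index_set J \<longrightarrow> (\<forall>j\<in>J. \<sigma> j > 0) \<longrightarrow>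
      0 < \<alpha> \<longrightarrow> \<alpha> < 1 \<longrightarrow> 0 < \<beta> \<longrightarrow> \<beta> < 1 \<longrightarrow>
      1 \<le> D \<longrightarrow> (\<forall>N. J = {1..N} \<longrightarrow> D \<le> N) \<longrightarrow>
        measure (noise J) {\<epsilon> \<in> space (noise J).
          (\<Sum>j=1..D. (\<sigma> j)\<^sup>2 * (\<epsilon> j)\<^sup>2) \<ge> chi_quantile J \<sigma> D (1 - \<alpha>)} = \<alpha>
      \<and> level_test J \<sigma> \<alpha> (chi_test J \<sigma> D \<alpha>)
      \<and> reject_prob J \<sigma> (\<lambda>_. 0) (chi_test J \<sigma> D \<alpha>) = \<alpha>
      \<and> (\<forall>\<theta>\<in>S_space J D.
          (l2_norm J \<theta>)\<^sup>2 \<ge> sep_const C \<alpha> \<beta> * sqrt (\<Sum>j=1..D. (\<sigma> j) ^ 4) \<longrightarrow>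
          reject_prob J \<sigma> \<theta> (chi_test J \<sigma> D \<alpha>) > 1 - \<beta>)
      \<and> (minimax_rate J \<sigma> (S_space J D) \<alpha> \<beta>)\<^sup>2
          \<le> ereal (sep_const C \<alpha> \<beta> * sqrt (\<Sum>j=1..D. (\<sigma> j) ^ 4)))"
proof (intro exI[of _ "12::real"] conjI allI impI)
  show "(12::real) > 0" by simp
next
  fix J :: "nat set" and \<sigma> :: "nat \<Rightarrow> real" and D :: nat and \<alpha> \<beta> :: real
  assume J: "index_set J" and pos': "\<forall>j\<in>J. \<sigma> j > 0"
    and \<alpha>: "0 < \<alpha>" "\<alpha> < 1" and \<beta>: "0 < \<beta>" "\<beta> < 1"
    and D: "1 \<le> D" and DN: "\<forall>N. J = {1..N} \<longrightarrow> D \<le> N"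
  have sub: "{1..D} \<subseteq> J" and J0: "0 \<notin> J"
    using J DN by (auto simp: index_set_def)
  have pos: "\<sigma> j > 0" if "j \<in> J" for j using pos' that by blast
  let ?\<Phi> = "chi_test J \<sigma> D \<alpha>" and ?K = "sep_const 12 \<alpha> \<beta> * sqrt (\<Sum>j=1..D. \<sigma> j ^ 4)"
  note exact = chi_quantile_exact[OF sub D pos \<alpha>]
  show "measure (noise J) {\<epsilon> \<in> space (noise J).
      (\<Sum>j=1..D. (\<sigma> j)\<^sup>2 * (\<epsilon> j)\<^sup>2) \<ge> chi_quantile J \<sigma> D (1 - \<alpha>)} = \<alpha>"
    by (rule exact(2))
  show size: "reject_prob J \<sigma> (\<lambda>_. 0) ?\<Phi> = \<alpha>"
    using exact(1) by (simp add: reject_prob_chi_test[OF sub] power_mult_distrib)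
  show level: "level_test J \<sigma> \<alpha> ?\<Phi>"
    unfolding level_test_def using chi_test_is_test[OF sub] size by simp
  have power: "reject_prob J \<sigma> \<theta> ?\<Phi> \<ge> 1 - \<alpha> * \<beta>"
    if "\<theta> \<in> S_space J D" "(l2_norm J \<theta>)\<^sup>2 \<ge> ?K" for \<theta>
    by (rule chi_test_power[OF sub J0 D pos \<alpha> \<beta> that])
  have strict: "1 - \<alpha> * \<beta> > 1 - \<beta>" using \<alpha> \<beta> by simp
  show "\<forall>\<theta>\<in>S_space J D. (l2_norm J \<theta>)\<^sup>2 \<ge> ?K \<longrightarrow> reject_prob J \<sigma> \<theta> ?\<Phi> > 1 - \<beta>"
    using power less_le_trans[OF strict] by blast
  have "?K > 0"
  proof (rule mult_pos_pos)
    show "sep_const 12 \<alpha> \<beta> > 0"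
    proof -
      have "ln (inverse \<alpha>) > 0" "ln (inverse \<beta>) > 0"
        using \<alpha> \<beta> by (simp_all add: ln_inverse)
      then show ?thesis
        unfolding sep_const_def by (intro mult_pos_pos add_pos_pos) auto
    qed
    show "sqrt (\<Sum>j=1..D. \<sigma> j ^ 4) > 0"
      by (rule sqrt_sum_fourth_pos) (use sub D pos in auto)
  qed
  then show "(minimax_rate J \<sigma> (S_space J D) \<alpha> \<beta>)\<^sup>2 \<le> ereal ?K"
    using level strict power by (intro minimax_rate_square_le)
qed

end
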